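(* (i) Let $A$ be a finite-dimensional semi-simple associative complex algebra and let $Z(A)^*$ be the group of invertible elements of its center $Z(A)$. Then the $(1+1)$-dimensional topological state sum built from $A$ enriches to a homotopical state sum (HSS) with target space $K(Z(A)^*,2)$. Reducing this $K(Z(A)^*,2)$-HSS to a group $G$ (i.e. to an HSS with target $K(G,2)$) amounts to giving a homomorphism $\varphi:G\to Z(A)^*$. (ii) Every HSS arises in this way: for an abelian group $G$, the HSSs with target $K(G,2)$ are in bijective correspondence with pairs $(A,\varphi)$, where $A$ is a semi-simple algebra and $\varphi:G\to Z(A)^*$ is a group homomorphism.
   Context: Fix a finite label set $\{0,\dots,n\}$ and let $A$ be the complex vector space with this set as basis. Repeated indices are summed. $G$ is an abelian group, written multiplicatively. **Topological state sum.** The data are complex numbers $C_{ijk}$, invariant under cyclic permutation of the indices, and a symmetric invertible matrix $g^{ij}$ with inverse $g_{ij}$; indices are raised and lowered with these, e.g. $C_{ij}{}^{k}=C_{ijl}\,g^{lk}$. For a closed oriented triangulated surface $(M,T)$ one labels each flag (edge $e$ of the graph dual to $T$, together with an endpoint $v$ of $e$) by an element of $\{0,\dots,n\}$, assigns $C_{ijk}$ to each dual vertex (triangle) whose incident flags are labelled $i,j,k$ in the cyclic order given by the orientation, assigns $g^{kk'}$ to each dual edge whose two flags are labelled $k,k'$, multiplies all factors, and sums over all labellings to obtain $Z(M,T)$. The data form a topological state sum if the weights satisfy the local constraints expressing invariance under changes of the triangulation (Pachner-type moves), namely $$C_{ij}{}^{p}C_{pk}{}^{l}=C_{jk}{}^{p}C_{ip}{}^{l},\qquad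 g_{ij}=C_{ik}{}^{l}C_{jl}{}^{k}.$$ The $C_{ij}{}^{k}$ are the structure constants of an associative multiplication on $A$ whose trace form $g_{ij}$ is non-degenerate; topological state sums correspond in this way bijectively to semi-simple associative algebra structures $A$ (the topological state sum built from $A$). **Homotopical state sum (HSS) with target $K(G,2)$.** The surface carries in addition a homotopy class of maps $M\to K(G,2)$, represented by an assignment of an element of $G$ to each triangle (with only the product of all of them being significant). The data are a metric, i.e. a symmetric invertible matrix $g^{ij}$ with inverse $g_{ij}$, used to raise and lower indices, and numbers $C_{ijk}(g)$, $g\in G$, cyclically invariant in the indices, with $C_{ijk}(g)$ used as the weight of a triangle coloured by $g$ (the rule for the sum being otherwise unchanged), such that $C_{ijk}:=C_{ijk}(1)$ together with $g^{ij}$ is a topological state sum and the weights satisfy the homotopy-invariance constraints $$C_{ij}{}^{k}(g)\,C_{klm}(h)=C_{ij}{}^{k}\,C_{klm}(gh)=C_{ij}{}^{k}(gh)\,C_{klm}\qquad(g,h\in G).$$ An HSS enriches the topological state sum given by $C_{ijk}(1)$ and $g^{ij}$. In the correspondence of the theorem, the algebra $A$ is the one with structure constants $C_{ij}{}^{k}(1)$, and, with $e$ the unit of $A$, $\varphi(g)=g\cdot e$, where $g\cdot a$ is the action of $G$ on $A$ whose matrix elements are the $C_{0j}{}^{k}(g)$ when the basis is chosen so that the element $0$ is the unit of $A$. *)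

theory Defs
  imports "HOL-Analysis.Analysis" "HOL-Algebra.Group"
begin

text \<open>
  The finite non-empty label set \<open>{0,...,n}\<close> is a type \<open>'n\<close> of class \<open>finite\<close> (so
  \<open>CARD('n) = n + 1\<close>), and the complex vector space with this basis is \<open>complex ^ 'n\<close> with basis
  vectors \<open>axis i 1\<close>. No label is distinguished.
\<close>

type_synonym 'n weight = "'n \<Rightarrow> 'n \<Rightarrow> 'n \<Rightarrow> complex"

text \<open>In all state sum data the stored matrix is the one with upper indices, \<open>g\<^sup>i\<^sup>j\<close>;
  the metric with lower indices is its \<open>matrix_inv\<close>.\<close>

definition raise :: "complex ^ 'n ^ 'n \<Rightarrow> 'n::finite weight \<Rightarrow> 'n weight" where
  "raise m C i j k = (\<Sum>l\<in>UNIV. C i j l * m $ l $ k)"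

definition cyclic :: "'n weight \<Rightarrow> bool" where
  "cyclic C \<longleftrightarrow> (\<forall>i j k. C i j k = C j k i)"

definition topological_state_sum :: "'n::finite weight \<times> (complex ^ 'n ^ 'n) \<Rightarrow> bool" where
  "topological_state_sum = (\<lambda>(C, m).
     cyclic C \<and> transpose m = m \<and> invertible m \<and>
     (\<forall>i j k l. (\<Sum>p\<in>UNIV. raise m C i j p * raise m C p k l)
              = (\<Sum>p\<in>UNIV. raise m C j k p * raise m C i p l)) \<and>
     (\<forall>i j. matrix_inv m $ i $ j = (\<Sum>k\<in>UNIV. \<Sum>l\<in>UNIV. raise m C i k l * raise m C j l k)))"

text \<open>The family of weights of a homotopical state sum is indexed by \<open>carrier G\<close>; it is required to be extensional so that equality of homotopical state sums
  means equality of their data.\<close>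

type_synonym ('g, 'n) hss_data = "('g \<Rightarrow> 'n weight) \<times> (complex ^ 'n ^ 'n)"

definition underlying_tss ::
    "('g, 'b) monoid_scheme \<Rightarrow> ('g, 'n::finite) hss_data \<Rightarrow> 'n weight \<times> (complex ^ 'n ^ 'n)" where
  "underlying_tss G = (\<lambda>(C, m). (C \<one>\<^bsub>G\<^esub>, m))"

definition hss :: "('g, 'b) monoid_scheme \<Rightarrow> ('g, 'n::finite) hss_data set" where
  "hss G = {(C, m).
     C \<in> extensional (carrier G) \<and>
     transpose m = m \<and> invertible m \<and>
     (\<forall>g\<in>carrier G. cyclic (C g)) \<and>
     topological_state_sum (underlying_tss G (C, m)) \<and>
     (\<forall>g\<in>carrier G. \<forall>h\<in>carrier G. \<forall>i j l p.
        (\<Sum>k\<in>UNIV. raise m (C g) i j k * C h k l p)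
          = (\<Sum>k\<in>UNIV. raise m (C \<one>\<^bsub>G\<^esub>) i j k * C (g \<otimes>\<^bsub>G\<^esub> h) k l p) \<and>
        (\<Sum>k\<in>UNIV. raise m (C \<one>\<^bsub>G\<^esub>) i j k * C (g \<otimes>\<^bsub>G\<^esub> h) k l p)
          = (\<Sum>k\<in>UNIV. raise m (C (g \<otimes>\<^bsub>G\<^esub> h)) i j k * C \<one>\<^bsub>G\<^esub> k l p))}"

text \<open>Reduction along a map of groups: a triangle coloured by \<open>g\<close> gets the weight of
  \<open>\<phi> g\<close>; the metric is unchanged.\<close>

definition reduce_hss ::
    "('g, 'b) monoid_scheme \<Rightarrow> ('g \<Rightarrow> 'h) \<Rightarrow> ('h, 'n::finite) hss_data \<Rightarrow> ('g, 'n) hss_data" where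
  "reduce_hss G \<phi> = (\<lambda>(C, m). (\<lambda>g\<in>carrier G. C (\<phi> g), m))"

text \<open>An algebra structure on \<open>complex ^ 'n\<close> is given by its multiplication.\<close>

type_synonym 'n multiplication = "complex ^ 'n \<Rightarrow> complex ^ 'n \<Rightarrow> complex ^ 'n"

definition associative_algebra :: "'n::finite multiplication \<Rightarrow> bool" where
  "associative_algebra A \<longleftrightarrow>
     (\<forall>x. Vector_Spaces.linear (*s) (*s) (\<lambda>y. A x y)) \<and>
     (\<forall>y. Vector_Spaces.linear (*s) (*s) (\<lambda>x. A x y)) \<and>
     (\<forall>x y z. A (A x y) z = A x (A y z))"

definition is_unit_of :: "'n::finite multiplication \<Rightarrow> complex ^ 'n \<Rightarrow> bool" where
  "is_unit_of A e \<longleftrightarrow> (\<forall>x. A e x = x \<and> A x e = x)"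

definition unit_of :: "'n::finite multiplication \<Rightarrow> complex ^ 'n" where
  "unit_of A = (THE e. is_unit_of A e)"

definition left_ideal :: "'n::finite multiplication \<Rightarrow> (complex ^ 'n) set \<Rightarrow> bool" where
  "left_ideal A I \<longleftrightarrow> vec.subspace I \<and> (\<forall>a. \<forall>x\<in>I. A a x \<in> I)"

text \<open>Semi-simplicity: the algebra is unital and semi-simple as a left module over itself,
  i.e. every left ideal is a direct summand.\<close>

definition semisimple_algebra :: "'n::finite multiplication \<Rightarrow> bool" where
  "semisimple_algebra A \<longleftrightarrow>
     associative_algebra A \<and> (\<exists>e. is_unit_of A e) \<and>
     (\<forall>I. left_ideal A I \<longrightarrow>
        (\<exists>J. left_ideal A J \<and> I \<inter> J = {0} \<and> {x + y |x y. x \<in> I \<and> y \<in> J} = UNIV))"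

definition center_monoid :: "'n::finite multiplication \<Rightarrow> (complex ^ 'n) monoid" where
  "center_monoid A =
     \<lparr>carrier = {z. \<forall>a. A z a = A a z}, monoid.mult = A, one = unit_of A\<rparr>"

definition center_units :: "'n::finite multiplication \<Rightarrow> (complex ^ 'n) monoid" where
  "center_units A = units_of (center_monoid A)"

text \<open>The topological state sum built from an algebra: \<open>C\<^sub>i\<^sub>j\<^sub>k\<close> is obtained from the structure
  constants by lowering the last index with the trace form.\<close>

definition structure_const :: "'n::finite multiplication \<Rightarrow> 'n weight" where
  "structure_const A i j k = A (axis i 1) (axis j 1) $ k"

definition trace_form :: "'n::finite multiplication \<Rightarrow> complex ^ 'n ^ 'n" where
  "trace_form A =
     (\<chi> i j. \<Sum>k\<in>UNIV. \<Sum>l\<in>UNIV. structure_const A i k l * structure_const A j l k)"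

definition tss_of_algebra :: "'n::finite multiplication \<Rightarrow> 'n weight \<times> (complex ^ 'n ^ 'n)" where
  "tss_of_algebra A =
     (\<lambda>i j k. \<Sum>l\<in>UNIV. structure_const A i j l * trace_form A $ l $ k, matrix_inv (trace_form A))"

text \<open>The bilinear map with coefficients \<open>C\<^sub>i\<^sub>j\<^sup>k(g)\<close>; for \<open>g = 1\<close> it is the multiplication of the
  algebra of the state sum.\<close>

definition hss_mult :: "('g, 'n::finite) hss_data \<Rightarrow> 'g \<Rightarrow> 'n multiplication" where
  "hss_mult = (\<lambda>(C, m) g x y. \<chi> k. \<Sum>i\<in>UNIV. \<Sum>j\<in>UNIV. x $ i * y $ j * raise m (C g) i j k)"

definition hss_algebra ::
    "('g, 'b) monoid_scheme \<Rightarrow> ('g, 'n::finite) hss_data \<Rightarrow> 'n multiplication" where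
  "hss_algebra G H = hss_mult H \<one>\<^bsub>G\<^esub>"

text \<open>The action of \<open>G\<close> on the algebra, written without choosing a basis that contains the unit:
  the index \<open>0\<close> in \<open>C\<^sub>0\<^sub>j\<^sup>k(g)\<close> means inserting the unit in the first argument, see the lemma
  \<open>hss_action_coeff\<close> below.\<close>

definition hss_action ::
    "('g, 'b) monoid_scheme \<Rightarrow> ('g, 'n::finite) hss_data \<Rightarrow> 'g \<Rightarrow> complex ^ 'n \<Rightarrow> complex ^ 'n" where
  "hss_action G H g a = hss_mult H g (unit_of (hss_algebra G H)) a"

lemma hss_action_coeff:
  fixes C :: "'g \<Rightarrow> 'n::finite weight"
  assumes "unit_of (hss_algebra G (C, m)) = axis o' 1"
  shows "hss_action G (C, m) g (axis j 1) $ k = raise m (C g) o' j k"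
proof -
  have ax: "(axis i 1 :: complex ^ 'n) $ j = (if j = i then 1 else 0)" for i j :: 'n
    by (simp add: axis_def)
  have delta: "(\<Sum>i\<in>UNIV. (if i = j then 1 else 0) * f i) = f j" for j :: 'n and f :: "'n \<Rightarrow> complex"
    by (simp add: if_distrib [of "\<lambda>x. x * _"] cong: if_cong)
  show ?thesis
    unfolding hss_action_def assms hss_mult_def prod.case vec_lambda_beta ax mult.assoc
      sum_distrib_left [symmetric] delta ..
qed

definition hss_hom ::
    "('g, 'b) monoid_scheme \<Rightarrow> ('g, 'n::finite) hss_data \<Rightarrow> 'g \<Rightarrow> complex ^ 'n" where
  "hss_hom G H = (\<lambda>g\<in>carrier G. hss_action G H g (unit_of (hss_algebra G H)))"

text \<open>Homomorphisms \<open>G \<rightarrow> Z(A)\<^sup>*\<close>, normalised outside \<open>carrier G\<close>.\<close>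

definition center_homs ::
    "('g, 'b) monoid_scheme \<Rightarrow> 'n::finite multiplication \<Rightarrow> ('g \<Rightarrow> complex ^ 'n) set" where
  "center_homs G A = hom G (center_units A) \<inter> extensional (carrier G)"

end

theory Submission
  imports Defs
begin

text \<open>
  For a semi-simple algebra the radical of the trace form is a left ideal, hence generated by an
  idempotent whose left multiplication has trace \<open>0\<close>; in characteristic \<open>0\<close> it vanishes, so the trace
  form is non-degenerate. Conversely, if the trace form is non-degenerate with dual bases \<open>e\<^sub>i\<close>, \<open>e\<^sup>i\<close>,
  then \<open>\<Sum>\<^sub>i e\<^sub>i e\<^sup>i\<close> is a unit and averaging over \<open>\<Sum>\<^sub>i e\<^sub>i \<otimes> e\<^sup>i\<close> splits every left ideal. So topological
  state sums and semi-simple algebras determine each other. The homotopy constraints say exactly that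
  the bilinear map with coefficients \<open>C\<^sub>i\<^sub>j\<^sup>k(g)\<close> is \<open>(x, y) \<mapsto> \<phi>(g) x y\<close> for a homomorphism \<open>\<phi>\<close>, and
  cyclicity of \<open>C(g)\<close> says that \<open>\<phi>(g)\<close> is central.
\<close>

section \<open>Linear maps between coordinate spaces and the trace of a projection\<close>

abbreviation linear_vec :: "(complex ^ 'n \<Rightarrow> complex ^ 'm) \<Rightarrow> bool" where
  "linear_vec \<equiv> Vector_Spaces.linear (*s) (*s)"

lemma linear_vecI:
  fixes f :: "complex ^ 'n::finite \<Rightarrow> complex ^ 'm::finite"
  assumes "\<And>x y. f (x + y) = f x + f y" "\<And>c x. f (c *s x) = c *s f x"
  shows "linear_vec f"
  using assms by unfold_locales auto

lemma linear_vec_expand: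
  fixes f :: "complex ^ 'n::finite \<Rightarrow> complex ^ 'm::finite"
  assumes "linear_vec f"
  shows "f x = (\<Sum>i\<in>UNIV. x $ i *s f (axis i 1))"
proof -
  have "f x = f (\<Sum>i\<in>UNIV. x $ i *s axis i 1)"
    by (simp add: basis_expansion)
  then show ?thesis
    by (simp add: vec.linear_sum [OF assms] vec.linear_scale [OF assms])
qed

lemma linear_vec_eqI:
  fixes f f' :: "complex ^ 'n::finite \<Rightarrow> complex ^ 'm::finite"
  assumes "linear_vec f" "linear_vec f'" "\<And>i. f (axis i 1) = f' (axis i 1)"
  shows "f x = f' x"
  by (simp add: linear_vec_expand [OF assms(1), of x] linear_vec_expand [OF assms(2), of x] assms(3))

text \<open>The trace of a projection is its rank, obtained here as \<open>card B\<close> for a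
  basis \<open>B\<close> of the range. In characteristic 0 a vanishing trace therefore forces
  \<open>B\<close> to be empty.\<close>

lemma trace_idempotent_eq_0:
  fixes P :: "complex ^ 'n::finite \<Rightarrow> complex ^ 'n"
  assumes lin: "linear_vec P" and idem: "\<And>x. P (P x) = P x" and tr: "trace (matrix P) = 0"
  shows "P x = 0"
proof -
  have "vec.subspace (range P)"
    by (rule vec.linear_subspace_image [OF lin vec.subspace_UNIV])
  then obtain B where B: "finite B" "B \<subseteq> range P" "vec.independent B" "vec.span B = range P"
    using vec.basis_subspace_exists by metis
  \<comment> \<open>The coordinates of \<open>P x\<close> in the basis \<open>B\<close>. They split
    \<open>P\<close> into the rank-one maps \<open>x \<mapsto> r b x *s b\<close>, each of trace
    \<open>r b b = 1\<close>.\<close>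
  define r where "r b x = vec.representation B (P x) b" for b x
  have span: "P x \<in> vec.span B" for x
    using B(4) by auto
  have r_add: "r b (x + y) = r b x + r b y" for b x y
    by (simp add: r_def vec.linear_add [OF lin] vec.representation_add [OF B(3)] span)
  have r_scale: "r b (c *s x) = c * r b x" for b c x
    by (simp add: r_def vec.linear_scale [OF lin] vec.representation_scale [OF B(3)] span)
  have r_0: "r b 0 = 0" for b
    using r_scale [of b 0 0] by simp
  have r_sum: "r b (\<Sum>i\<in>S. f i) = (\<Sum>i\<in>S. r b (f i))" if "finite S" for b S and f :: "'n \<Rightarrow> complex ^ 'n"
    using that by (induction S) (auto simp: r_0 r_add)
  have P_eq: "P x = (\<Sum>b\<in>B. r b x *s b)" for x
    unfolding r_def using vec.sum_representation_eq [OF B(3) span B(1) order_refl] by simp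
  have r_B: "r b b = 1" if "b \<in> B" for b
  proof -
    have "P b = b"
      using B(2) that idem by auto
    then show ?thesis
      using vec.representation_basis [OF B(3) that] by (simp add: r_def)
  qed
  have "trace (matrix P) = (\<Sum>i\<in>UNIV. \<Sum>b\<in>B. r b (axis i 1) * b $ i)"
    by (simp add: trace_def matrix_def P_eq)
  also have "\<dots> = (\<Sum>b\<in>B. r b (\<Sum>i\<in>UNIV. b $ i *s axis i 1))"
    by (subst sum.swap) (simp add: r_sum r_scale mult.commute)
  also have "\<dots> = of_nat (card B)"
    by (simp add: basis_expansion r_B)
  finally have "B = {}"
    using tr B(1) by simp
  then show ?thesis
    using B(4) by auto
qed

lemma matrix_inv:
  assumes "invertible M"
  shows "M ** matrix_inv M = mat 1" "matrix_inv M ** M = mat 1"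
  using assms unfolding invertible_def matrix_inv_def by (metis (mono_tags, lifting) someI_ex)+

section \<open>Bilinear and associative multiplications and the trace of left multiplication\<close>

locale bilinear_mult =
  fixes A :: "'n::finite multiplication" (infixl "\<odot>" 70)
  assumes linear_right: "linear_vec (\<lambda>y. x \<odot> y)"
    and linear_left: "linear_vec (\<lambda>x. x \<odot> y)"
begin

lemmas add_right = vec.linear_add [OF linear_right]
lemmas add_left = vec.linear_add [OF linear_left]
lemmas diff_left = vec.linear_diff [OF linear_left]
lemmas scale_right = vec.linear_scale [OF linear_right]
lemmas scale_left = vec.linear_scale [OF linear_left]
lemmas sum_right = vec.linear_sum [OF linear_right]
lemmas sum_left = vec.linear_sum [OF linear_left]
lemmas zero_right = vec.linear_0 [OF linear_right]
lemmas zero_left = vec.linear_0 [OF linear_left]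

lemma nth_mult: "(x \<odot> y) $ k = (\<Sum>i\<in>UNIV. \<Sum>j\<in>UNIV. x $ i * y $ j * structure_const A i j k)"
  by (subst linear_vec_expand [OF linear_left], subst linear_vec_expand [OF linear_right])
     (simp add: structure_const_def sum_distrib_left mult.assoc)

text \<open>The character of the left regular representation; for an associative multiplication the
  trace form is \<open>ltrace (x \<odot> y)\<close>.\<close>

definition ltrace :: "complex ^ 'n \<Rightarrow> complex" where
  "ltrace x = trace (matrix (A x))"

lemma ltrace_eq: "ltrace x = (\<Sum>i\<in>UNIV. (x \<odot> axis i 1) $ i)"
  by (simp add: ltrace_def trace_def matrix_def)

lemma ltrace_add: "ltrace (x + y) = ltrace x + ltrace y"
  by (simp add: ltrace_eq add_left sum.distrib)

lemma ltrace_diff: "ltrace (x - y) = ltrace x - ltrace y"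
  by (simp add: ltrace_eq diff_left sum_subtractf)

lemma ltrace_scale: "ltrace (c *s x) = c * ltrace x"
  by (simp add: ltrace_eq scale_left sum_distrib_left)

lemma ltrace_0: "ltrace 0 = 0"
  by (simp add: ltrace_eq zero_left)

lemma ltrace_sum: "ltrace (\<Sum>i\<in>S. f i) = (\<Sum>i\<in>S. ltrace (f i))"
  by (simp add: ltrace_eq sum_left) (rule sum.swap)

end

locale assoc_mult = bilinear_mult A for A :: "'n::finite multiplication" (infixl "\<odot>" 70) +
  assumes assoc: "(x \<odot> y) \<odot> z = x \<odot> (y \<odot> z)"
begin

lemma matrix_mult: "matrix (A (x \<odot> y)) = matrix (A x) ** matrix (A y)"
proof -
  have "A (x \<odot> y) = A x \<circ> A y"
    by (simp add: fun_eq_iff assoc)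
  then show ?thesis
    using matrix_compose_gen [OF linear_right linear_right, of x y] by simp
qed

lemma ltrace_commute: "ltrace (x \<odot> y) = ltrace (y \<odot> x)"
  unfolding ltrace_def matrix_mult by (rule trace_mul_sym)

text \<open>The double sum defining \<open>trace_form\<close> is the trace of a product of two left
  multiplication matrices, which associativity merges into one.\<close>

lemma trace_form_nth: "trace_form A $ i $ j = ltrace (axis i 1 \<odot> axis j 1)"
proof -
  have "trace_form A $ i $ j = trace (matrix (A (axis i 1)) ** matrix (A (axis j 1)))"
    unfolding trace_form_def trace_def matrix_matrix_mult_def matrix_def structure_const_def
      vec_lambda_beta by (subst sum.swap) (simp only: mult.commute)
  then show ?thesis
    by (simp add: matrix_mult ltrace_def)
qed

lemma trace_form_sym: "transpose (trace_form A) = trace_form A"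
  by (simp add: transpose_def vec_eq_iff trace_form_nth ltrace_commute)

lemma sum_trace_form: "(\<Sum>l\<in>UNIV. x $ l * trace_form A $ l $ k) = ltrace (x \<odot> axis k 1)"
proof -
  have "ltrace (x \<odot> axis k 1) = ltrace ((\<Sum>l\<in>UNIV. x $ l *s axis l 1) \<odot> axis k 1)"
    by (simp add: basis_expansion)
  then show ?thesis
    by (simp add: sum_left scale_left ltrace_sum ltrace_scale trace_form_nth)
qed

lemma ltrace_axis_0:
  assumes "\<And>k. ltrace (x \<odot> axis k 1) = 0"
  shows "ltrace (x \<odot> y) = 0"
proof -
  have "ltrace (x \<odot> y) = ltrace (x \<odot> (\<Sum>l\<in>UNIV. y $ l *s axis l 1))"
    by (simp add: basis_expansion)
  then show ?thesis
    by (simp add: sum_right scale_right ltrace_sum ltrace_scale assms)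
qed

lemma trace_form_vector: "(trace_form A *v x) $ k = ltrace (x \<odot> axis k 1)"
proof -
  have "(trace_form A *v x) $ k = (x v* trace_form A) $ k"
    by (metis trace_form_sym transpose_matrix_vector)
  then show ?thesis
    by (simp add: vector_matrix_mult_def sum_trace_form [symmetric] mult.commute)
qed

text \<open>The kernel of the matrix is the radical of the form, and a square matrix is invertible
  as soon as its kernel is zero.\<close>

lemma invertible_trace_form_iff:
  "invertible (trace_form A) \<longleftrightarrow> (\<forall>x. (\<forall>y. ltrace (x \<odot> y) = 0) \<longrightarrow> x = 0)"
proof -
  have "trace_form A *v x = 0 \<longleftrightarrow> (\<forall>y. ltrace (x \<odot> y) = 0)" for x
    by (auto simp: vec_eq_iff trace_form_vector intro: ltrace_axis_0)
  then show ?thesis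
    by (simp add: invertible_left_inverse matrix_left_invertible_ker)
qed

text \<open>The radical of the trace form is a left ideal, hence of the form \<open>A e\<close> with \<open>e\<close> idempotent;
  left multiplication by \<open>e\<close> is then a projection of trace \<open>0\<close>.\<close>

lemma semisimple_imp_invertible_trace_form:
  assumes "semisimple_algebra A"
  shows "invertible (trace_form A)"
proof -
  define N where "N = {x. \<forall>y. ltrace (x \<odot> y) = 0}"
  have N_mult: "a \<odot> x \<in> N" if "x \<in> N" for a x
  proof -
    have "ltrace (a \<odot> x \<odot> y) = ltrace (x \<odot> (y \<odot> a))" for y
      by (simp only: assoc ltrace_commute [of a])
    then show ?thesis
      using that by (simp add: N_def)
  qed
  have "left_ideal A N"
    unfolding left_ideal_def vec.subspace_def using N_mult
    by (auto simp: N_def zero_left add_left scale_left ltrace_0 ltrace_add ltrace_scale)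
  then obtain J where J: "left_ideal A J" "N \<inter> J = {0}" "{x + y |x y. x \<in> N \<and> y \<in> J} = UNIV"
    using assms unfolding semisimple_algebra_def by blast
  obtain u where u: "is_unit_of A u"
    using assms unfolding semisimple_algebra_def by blast
  \<comment> \<open>The component \<open>e\<close> of the unit in \<open>N\<close> is a right
    identity on \<open>N\<close>: for \<open>x\<close> in \<open>N\<close>, the remainder
    \<open>x \<odot> f = x - x \<odot> e\<close> lies in both \<open>N\<close> and
    \<open>J\<close>.\<close>
  obtain e f where ef: "u = e + f" "e \<in> N" "f \<in> J"
    using J(3) by blast
  have N_fix: "x \<odot> e = x" if "x \<in> N" for x
  proof -
    have eq: "x = x \<odot> e + x \<odot> f"
      using u by (simp add: add_right [symmetric] ef(1) [symmetric] is_unit_of_def)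
    have "x \<odot> f \<in> J"
      using J(1) ef(3) by (simp add: left_ideal_def)
    moreover have "x \<odot> f = x - x \<odot> e"
      by (subst (2) eq) simp
    then have "x \<odot> f \<in> N"
      using \<open>left_ideal A N\<close> that N_mult [OF ef(2)] by (simp add: left_ideal_def vec.subspace_diff)
    ultimately have "x \<odot> f = 0"
      using J(2) by blast
    then show ?thesis
      using eq by simp
  qed
  \<comment> \<open>Pairing \<open>e\<close>, an element of the radical, with the unit gives its
    trace.\<close>
  have "ltrace e = 0"
    using ef(2) u spec [of "\<lambda>y. ltrace (e \<odot> y) = 0" u] by (simp add: N_def is_unit_of_def)
  then have "e \<odot> x = 0" for x
    using trace_idempotent_eq_0 [OF linear_right, of e x] N_fix [OF ef(2)]
    by (simp add: assoc [symmetric] ltrace_def)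
  moreover have "e \<odot> u = e"
    using u by (simp add: is_unit_of_def)
  ultimately have "e = 0"
    by simp
  then have "x = 0" if "x \<in> N" for x
    using N_fix [OF that] by (simp add: zero_right)
  then show ?thesis
    by (simp add: invertible_trace_form_iff N_def)
qed

end

lemma associative_algebra_iff: "associative_algebra A \<longleftrightarrow> assoc_mult A"
  by (auto simp: associative_algebra_def assoc_mult_def bilinear_mult_def assoc_mult_axioms_def)

section \<open>Non-degenerate trace forms: dual basis, Casimir element, unit,
  semi-simplicity\<close>

locale frobenius_mult = assoc_mult A for A :: "'n::finite multiplication" (infixl "\<odot>" 70) +
  assumes invertible_trace_form: "invertible (trace_form A)"
begin

lemma nondegenerate: "x = 0" if "\<And>y. ltrace (x \<odot> y) = 0"
  using invertible_trace_form that by (simp add: invertible_trace_form_iff)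

lemma eqI_ltrace: "x = x'" if "\<And>y. ltrace (x \<odot> y) = ltrace (x' \<odot> y)"
  using nondegenerate [of "x - x'"] that by (simp add: diff_left ltrace_diff)

definition dual :: "'n \<Rightarrow> complex ^ 'n" where
  "dual i = (\<chi> j. matrix_inv (trace_form A) $ i $ j)"

lemma ltrace_dual_axis: "ltrace (dual i \<odot> axis k 1) = (if i = k then 1 else 0)"
proof -
  have "ltrace (dual i \<odot> axis k 1) = (matrix_inv (trace_form A) ** trace_form A) $ i $ k"
    by (simp add: sum_trace_form [symmetric] dual_def matrix_matrix_mult_def)
  then show ?thesis
    using matrix_inv(2) [OF invertible_trace_form] by (simp add: mat_def)
qed

lemma ltrace_dual: "ltrace (dual i \<odot> x) = x $ i"
proof -
  have "ltrace (dual i \<odot> x) = ltrace (dual i \<odot> (\<Sum>l\<in>UNIV. x $ l *s axis l 1))"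
    by (simp add: basis_expansion)
  also have "\<dots> = x $ i"
    by (simp add: sum_right scale_right ltrace_sum ltrace_scale ltrace_dual_axis if_distrib
        cong: if_cong)
  finally show ?thesis .
qed

lemma axis_expansion: "x = (\<Sum>i\<in>UNIV. ltrace (dual i \<odot> x) *s axis i 1)"
  by (simp add: ltrace_dual basis_expansion)

lemma dual_expansion: "x = (\<Sum>i\<in>UNIV. ltrace (axis i 1 \<odot> x) *s dual i)"
proof (rule eqI_ltrace)
  fix y
  have "ltrace (x \<odot> y) = ltrace (x \<odot> (\<Sum>i\<in>UNIV. y $ i *s axis i 1))"
    by (simp add: basis_expansion)
  then show "ltrace (x \<odot> y) = ltrace ((\<Sum>i\<in>UNIV. ltrace (axis i 1 \<odot> x) *s dual i) \<odot> y)"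
    by (simp add: sum_left sum_right scale_left scale_right ltrace_sum ltrace_scale ltrace_dual
        mult.commute ltrace_commute [of x])
qed

text \<open>The Casimir element, the sum of \<open>axis i 1\<close> tensor \<open>dual i\<close>,
  commutes with \<open>a\<close>; an arbitrary bilinear \<open>F\<close> stands in for the tensor
  product. Expanding in the basis on the left and in the dual basis on the right yields coefficients
  that agree by cyclicity of the trace.\<close>

lemma casimir:
  fixes F :: "complex ^ 'n \<Rightarrow> complex ^ 'n \<Rightarrow> complex ^ 'n"
  assumes left: "\<And>y. linear_vec (\<lambda>x. F x y)" and right: "\<And>x. linear_vec (F x)"
  shows "(\<Sum>i\<in>UNIV. F (a \<odot> axis i 1) (dual i)) = (\<Sum>i\<in>UNIV. F (axis i 1) (dual i \<odot> a))"
proof -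
  have l: "F (a \<odot> axis i 1) (dual i)
      = (\<Sum>k\<in>UNIV. ltrace (dual k \<odot> (a \<odot> axis i 1)) *s F (axis k 1) (dual i))" for i
    by (subst axis_expansion [of "a \<odot> axis i 1"])
       (simp add: vec.linear_sum [OF left] vec.linear_scale [OF left])
  have r: "F (axis k 1) (dual k \<odot> a)
      = (\<Sum>i\<in>UNIV. ltrace (axis i 1 \<odot> (dual k \<odot> a)) *s F (axis k 1) (dual i))" for k
    by (subst dual_expansion [of "dual k \<odot> a"])
       (simp add: vec.linear_sum [OF right] vec.linear_scale [OF right])
  have "ltrace (axis i 1 \<odot> (dual k \<odot> a)) = ltrace (dual k \<odot> (a \<odot> axis i 1))" for i k
    by (subst ltrace_commute) (simp add: assoc)
  then show ?thesis
    unfolding l r by (subst sum.swap) simp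
qed

text \<open>The unit is constructed rather than assumed: it is the image of the Casimir element
  under multiplication, and the vector representing the functional \<open>ltrace\<close>.\<close>

definition unit :: "complex ^ 'n" where
  "unit = (\<Sum>i\<in>UNIV. axis i 1 \<odot> dual i)"

text \<open>\<open>ltrace y\<close> sums the \<open>i\<close>-th coordinates of
  \<open>y \<odot> axis i 1\<close>, which are pairings with \<open>dual i\<close>; cyclicity of the
  trace moves \<open>axis i 1\<close> to the front.\<close>

lemma ltrace_unit: "ltrace (unit \<odot> y) = ltrace y"
proof -
  have "ltrace (unit \<odot> y) = (\<Sum>i\<in>UNIV. ltrace (axis i 1 \<odot> (dual i \<odot> y)))"
    by (simp add: unit_def sum_left ltrace_sum assoc)
  also have "\<dots> = (\<Sum>i\<in>UNIV. ltrace (dual i \<odot> (y \<odot> axis i 1)))"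
    by (intro sum.cong refl) (subst ltrace_commute, simp add: assoc)
  finally show ?thesis
    by (simp add: ltrace_dual ltrace_eq [of y])
qed

lemma unit_left: "unit \<odot> x = x"
  by (rule eqI_ltrace) (simp add: assoc ltrace_unit)

lemma unit_right: "x \<odot> unit = x"
proof (rule eqI_ltrace)
  show "ltrace (x \<odot> unit \<odot> y) = ltrace (x \<odot> y)" for y
    by (simp add: assoc unit_left)
qed

lemma is_unit_of_iff: "is_unit_of A e \<longleftrightarrow> e = unit"
  unfolding is_unit_of_def by (metis unit_left unit_right)

lemma unit_of_eq: "unit_of A = unit"
  by (simp add: unit_of_def is_unit_of_iff)

text \<open>As the Casimir element \<open>\<Sum>\<^sub>i e\<^sub>i \<otimes> dual i\<close> multiplies to the unit, averaging over it turns a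
  linear projection onto a left ideal into a module homomorphism, as in Maschke's theorem.\<close>

lemma semisimple: "semisimple_algebra A"
  unfolding semisimple_algebra_def
proof (intro conjI allI impI)
  show "associative_algebra A"
    by (simp add: associative_algebra_iff assoc_mult_axioms)
  show "\<exists>e. is_unit_of A e"
    by (simp add: is_unit_of_iff)
  fix I assume I: "left_ideal A I"
  then have sub: "vec.subspace I"
    by (simp add: left_ideal_def)
  obtain p where p: "range p \<subseteq> I" "linear_vec p" "\<And>v. v \<in> I \<Longrightarrow> p v = v"
    using vec.linear_exists_left_inverse_on [OF vec.linear_id sub] by auto
  define q where "q x = (\<Sum>i\<in>UNIV. axis i 1 \<odot> p (dual i \<odot> x))" for x
  note p_simps = vec.linear_add [OF p(2)] vec.linear_scale [OF p(2)]
  have q_lin: "linear_vec q"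
    by (rule linear_vecI)
       (simp_all add: q_def add_right scale_right p_simps sum.distrib vec.scale_sum_right)
  have q_in: "q x \<in> I" for x
    unfolding q_def using I p(1) by (intro vec.subspace_sum sub) (auto simp: left_ideal_def)
  have q_fix: "q x = x" if "x \<in> I" for x
  proof -
    have "p (dual i \<odot> x) = dual i \<odot> x" for i
      using I that by (auto simp: left_ideal_def intro: p(3))
    then have "q x = unit \<odot> x"
      by (simp add: q_def unit_def sum_left assoc)
    then show ?thesis
      by (simp add: unit_left)
  qed
  have q_mult: "q (a \<odot> x) = a \<odot> q x" for a x
  proof -
    have "a \<odot> q x = (\<Sum>i\<in>UNIV. (a \<odot> axis i 1) \<odot> p (dual i \<odot> x))"
      by (simp add: q_def sum_right assoc)
    also have "\<dots> = (\<Sum>i\<in>UNIV. axis i 1 \<odot> p (dual i \<odot> a \<odot> x))"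
      by (rule casimir [of "\<lambda>u v. u \<odot> p (v \<odot> x)"])
         (auto intro!: linear_vecI simp: add_left add_right scale_left scale_right p_simps)
    finally show ?thesis
      by (simp add: q_def assoc)
  qed
  define J where "J = {x. q x = 0}"
  show "\<exists>J. left_ideal A J \<and> I \<inter> J = {0} \<and> {x + y |x y. x \<in> I \<and> y \<in> J} = UNIV"
  proof (intro exI conjI)
    show "left_ideal A J"
      unfolding left_ideal_def J_def vec.subspace_def
      by (auto simp: q_mult zero_right vec.linear_0 [OF q_lin] vec.linear_add [OF q_lin]
          vec.linear_scale [OF q_lin])
    show "I \<inter> J = {0}"
      using q_fix vec.subspace_0 [OF sub] by (auto simp: J_def vec.linear_0 [OF q_lin])
    have "x = q x + (x - q x)" "x - q x \<in> J" for x
      using q_fix [OF q_in] by (auto simp: J_def vec.linear_diff [OF q_lin])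
    then show "{x + y |x y. x \<in> I \<and> y \<in> J} = UNIV"
      using q_in by blast
  qed
qed

end

text \<open>Replaces the condition on left ideals by non-degeneracy, so that everything about
  semi-simple algebras below can be computed inside the locale.\<close>

lemma semisimple_algebra_iff: "semisimple_algebra A \<longleftrightarrow> frobenius_mult A"
proof
  assume A: "semisimple_algebra A"
  then interpret assoc_mult A
    by (simp add: semisimple_algebra_def associative_algebra_iff)
  show "frobenius_mult A"
    by unfold_locales (rule semisimple_imp_invertible_trace_form [OF A])
qed (rule frobenius_mult.semisimple)

section \<open>Multilinear maps and their coefficients; raising and lowering indices\<close>

lemma trilinear_eqI:
  fixes F F' :: "complex ^ 'n::finite \<Rightarrow> complex ^ 'n \<Rightarrow> complex ^ 'n \<Rightarrow> complex ^ 'n"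
  assumes "\<And>y z. linear_vec (\<lambda>x. F x y z)" "\<And>x z. linear_vec (\<lambda>y. F x y z)"
    "\<And>x y. linear_vec (F x y)"
    and "\<And>y z. linear_vec (\<lambda>x. F' x y z)" "\<And>x z. linear_vec (\<lambda>y. F' x y z)"
    "\<And>x y. linear_vec (F' x y)"
    and eq: "\<And>i j k. F (axis i 1) (axis j 1) (axis k 1) = F' (axis i 1) (axis j 1) (axis k 1)"
  shows "F x y z = F' x y z"
proof -
  have "F (axis i 1) (axis j 1) z = F' (axis i 1) (axis j 1) z" for i j z
    by (rule linear_vec_eqI [OF assms(3,6) eq])
  then have "F (axis i 1) y z = F' (axis i 1) y z" for i y z
    by (rule linear_vec_eqI [OF assms(2,5)])
  then show ?thesis
    by (rule linear_vec_eqI [OF assms(1,4)])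
qed

lemma matrix_inv_eqI:
  fixes M N :: "complex ^ 'n::finite ^ 'n"
  assumes "M ** N = mat 1"
  shows "matrix_inv M = N"
proof -
  have "invertible M"
    using assms invertible_right_inverse by blast
  then have "matrix_inv M ** (M ** N) = N"
    by (simp add: matrix_mul_assoc matrix_inv(2))
  then show ?thesis
    by (simp add: assms)
qed

lemma matrix_inv_matrix_inv:
  fixes M :: "complex ^ 'n::finite ^ 'n"
  assumes "invertible M"
  shows "matrix_inv (matrix_inv M) = M"
  by (intro matrix_inv_eqI matrix_inv(2) assms)

lemma invertible_matrix_inv:
  fixes M :: "complex ^ 'n::finite ^ 'n"
  assumes "invertible M"
  shows "invertible (matrix_inv M)"
  using matrix_inv [OF assms] unfolding invertible_def by blast

lemma raise_raise: "raise M (raise N C) = raise (N ** M) C"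
  by (simp add: raise_def matrix_matrix_mult_def fun_eq_iff sum_distrib_left sum_distrib_right
      mult.assoc) (intro allI, rule sum.swap)

lemma raise_mat_1: "raise (mat 1) C = C"
  by (simp add: raise_def mat_def fun_eq_iff if_distrib cong: if_cong)

lemma raise_raise_matrix_inv:
  assumes "invertible M"
  shows "raise M (raise (matrix_inv M) C) = C" "raise (matrix_inv M) (raise M C) = C"
  by (simp_all add: raise_raise raise_mat_1 matrix_inv [OF assms])

lemma raise_eq_iff:
  assumes "invertible M"
  shows "raise M C = C' \<longleftrightarrow> C = raise (matrix_inv M) C'"
  using raise_raise_matrix_inv [OF assms] by metis

lemma (in bilinear_mult) nth_mult_axis:
  "(x \<odot> axis k 1) $ l = (\<Sum>p\<in>UNIV. x $ p * structure_const A p k l)"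
  by (subst linear_vec_expand [OF linear_left]) (simp add: structure_const_def)

lemma (in bilinear_mult) nth_axis_mult:
  "(axis k 1 \<odot> x) $ l = (\<Sum>p\<in>UNIV. x $ p * structure_const A k p l)"
  by (subst linear_vec_expand [OF linear_right]) (simp add: structure_const_def)

lemma bilinear_hss_mult: "bilinear_mult (hss_mult (C, m) g)"
  by (intro bilinear_mult.intro linear_vecI)
     (simp_all add: hss_mult_def vec_eq_iff algebra_simps sum.distrib sum_distrib_left)

lemma structure_const_hss_mult: "structure_const (hss_mult (C, m) g) = raise m (C g)"
proof -
  have delta: "(\<Sum>a\<in>UNIV. axis i 1 $ a * f a) = f i" for i :: 'a and f :: "'a \<Rightarrow> complex"
    by (simp add: axis_def if_distrib [of "\<lambda>x. x * _"] cong: if_cong)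
  show ?thesis
    by (simp add: structure_const_def hss_mult_def fun_eq_iff mult.assoc
        sum_distrib_left [symmetric] delta)
qed

lemma hss_mult_eqI:
  assumes "bilinear_mult B" "raise m (C g) = structure_const B"
  shows "hss_mult (C, m) g = B"
  by (simp add: hss_mult_def assms(2) fun_eq_iff vec_eq_iff bilinear_mult.nth_mult [OF assms(1)])

text \<open>The inverse of the correspondence. Applying \<open>raise\<close> with the lower-index
  metric \<open>trace_form A\<close> lowers the last index. It is defined for every
  \<open>A\<close>, outside the locale, so that it can serve as the inverse map in a bijection
  ranging over all algebras.\<close>

definition hss_of ::
    "('g, 'b) monoid_scheme \<Rightarrow> 'n::finite multiplication \<Rightarrow> ('g \<Rightarrow> complex ^ 'n) \<Rightarrow> ('g, 'n) hss_data"
  where "hss_of G A \<phi> =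
    (\<lambda>g\<in>carrier G. raise (trace_form A) (structure_const (\<lambda>x y. A (\<phi> g) (A x y))),
     matrix_inv (trace_form A))"

lemma (in assoc_mult) bilinear_shifted: "bilinear_mult (\<lambda>x y. z \<odot> (x \<odot> y))"
  by (intro bilinear_mult.intro linear_vecI)
     (simp_all add: add_left add_right scale_left scale_right)

section \<open>Weights given by an element of the algebra\<close>

context frobenius_mult
begin

definition weight :: "complex ^ 'n \<Rightarrow> 'n weight" where
  "weight z = raise (trace_form A) (structure_const (\<lambda>x y. z \<odot> (x \<odot> y)))"

lemma weight_eq: "weight z i j k = ltrace (z \<odot> (axis i 1 \<odot> axis j 1) \<odot> axis k 1)"
  by (simp add: weight_def raise_def structure_const_def sum_trace_form)

lemma sum_weight: "(\<Sum>k\<in>UNIV. v $ k * weight z k l p) = ltrace (z \<odot> (v \<odot> axis l 1) \<odot> axis p 1)"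
  by (subst (2) basis_expansion [of v, symmetric])
     (simp add: weight_eq sum_left sum_right scale_left scale_right ltrace_sum ltrace_scale)

lemma raise_weight:
  "raise (matrix_inv (trace_form A)) (weight z) = structure_const (\<lambda>x y. z \<odot> (x \<odot> y))"
  by (simp add: weight_def raise_raise_matrix_inv(2) invertible_trace_form)

text \<open>The weight is the trace of \<open>z\<close> times a triple product; a central
  \<open>z\<close> does not obstruct the cyclicity of the trace.\<close>

lemma cyclic_weight:
  assumes "\<And>a. z \<odot> a = a \<odot> z"
  shows "cyclic (weight z)"
proof -
  have rotate: "ltrace (z \<odot> (x \<odot> y) \<odot> w) = ltrace (z \<odot> (y \<odot> w) \<odot> x)" for x y w
  proof -
    have "ltrace (z \<odot> (x \<odot> y) \<odot> w) = ltrace (x \<odot> (z \<odot> (y \<odot> w)))"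
      by (metis assms assoc)
    then show ?thesis
      by (simp add: ltrace_commute)
  qed
  then show ?thesis
    unfolding cyclic_def weight_eq by (intro allI) (rule rotate)
qed

text \<open>With the unit inserted in the middle slot, one rotation turns the trace of
  \<open>z \<odot> axis k 1 \<odot> axis p 1\<close> into that of
  \<open>z \<odot> axis p 1 \<odot> axis k 1\<close>, hence of
  \<open>axis k 1 \<odot> z \<odot> axis p 1\<close>. Non-degeneracy then cancels
  \<open>axis p 1\<close>.\<close>

lemma cyclic_weight_imp_central:
  assumes "cyclic (weight z)"
  shows "z \<odot> a = a \<odot> z"
proof -
  have trace: "ltrace (z \<odot> axis k 1 \<odot> axis p 1) = ltrace (axis k 1 \<odot> z \<odot> axis p 1)" for k p
  proof -
    have expand: "ltrace (z \<odot> (axis k 1 \<odot> v) \<odot> axis p 1) = (\<Sum>l\<in>UNIV. v $ l * weight z k l p)" for v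
      by (subst basis_expansion [of v, symmetric])
         (simp add: weight_eq sum_left sum_right scale_left scale_right ltrace_sum ltrace_scale)
    have rotate: "weight z k l p = weight z l p k" for l
      by (rule assms [unfolded cyclic_def, rule_format])
    have "ltrace (z \<odot> (axis k 1 \<odot> unit) \<odot> axis p 1)
        = ltrace (z \<odot> (unit \<odot> axis p 1) \<odot> axis k 1)"
      unfolding expand rotate by (rule sum_weight)
    also have "\<dots> = ltrace (axis k 1 \<odot> (z \<odot> axis p 1))"
      by (subst ltrace_commute) (simp add: unit_left)
    finally show ?thesis
      by (simp add: unit_right assoc)
  qed
  have "z \<odot> axis k 1 - axis k 1 \<odot> z = 0" for k
    by (rule nondegenerate, rule ltrace_axis_0) (simp add: diff_left ltrace_diff trace)
  then have "z \<odot> axis k 1 = axis k 1 \<odot> z" for k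
    by simp
  then show ?thesis
    by (rule linear_vec_eqI [OF linear_right linear_left])
qed

lemma tss_of_algebra_eq: "tss_of_algebra A = (weight unit, matrix_inv (trace_form A))"
  by (simp add: tss_of_algebra_def weight_def unit_left raise_def fun_eq_iff)

lemma transpose_matrix_inv_trace_form:
  "transpose (matrix_inv (trace_form A)) = matrix_inv (trace_form A)"
proof -
  have "trace_form A ** transpose (matrix_inv (trace_form A)) = mat 1"
    by (metis matrix_inv(2) invertible_trace_form matrix_transpose_mul trace_form_sym transpose_mat)
  then show ?thesis
    by (rule matrix_inv_eqI [symmetric])
qed

text \<open>The first constraint is associativity in coordinates, the second is the definition of
  the trace form, and cyclicity is \<open>cyclic_weight\<close> for the unit.\<close>

lemma topological_state_sum_tss_of_algebra: "topological_state_sum (tss_of_algebra A)"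
proof -
  have "(\<Sum>p\<in>UNIV. structure_const A i j p * structure_const A p k l)
      = (\<Sum>p\<in>UNIV. structure_const A j k p * structure_const A i p l)" for i j k l
    using nth_mult_axis [of "axis i 1 \<odot> axis j 1" k l] nth_axis_mult [of i "axis j 1 \<odot> axis k 1" l]
    by (simp add: structure_const_def assoc)
  moreover have "raise (matrix_inv (trace_form A)) (weight unit) = structure_const A"
    by (simp add: raise_weight unit_left)
  moreover have "cyclic (weight unit)"
    by (rule cyclic_weight) (simp add: unit_left unit_right)
  moreover have "trace_form A $ i $ j
      = (\<Sum>k\<in>UNIV. \<Sum>l\<in>UNIV. structure_const A i k l * structure_const A j l k)" for i j
    by (simp add: trace_form_def)
  ultimately show ?thesis
    by (simp add: topological_state_sum_def tss_of_algebra_eq transpose_matrix_inv_trace_form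
        invertible_matrix_inv matrix_inv_matrix_inv invertible_trace_form)
qed

section \<open>The group of central units\<close>

lemma comm_monoid_center: "comm_monoid (center_monoid A)"
proof (rule comm_monoidI)
  fix x y assume "x \<in> carrier (center_monoid A)" "y \<in> carrier (center_monoid A)"
  then have x: "x \<odot> a = a \<odot> x" and y: "y \<odot> a = a \<odot> y" for a
    by (auto simp: center_monoid_def)
  have "x \<odot> y \<odot> a = a \<odot> (x \<odot> y)" for a
  proof -
    have "x \<odot> y \<odot> a = x \<odot> a \<odot> y"
      by (simp only: assoc y [of a])
    also have "\<dots> = a \<odot> (x \<odot> y)"
      by (simp only: x [of a] assoc)
    finally show ?thesis .
  qed
  then show "x \<otimes>\<^bsub>center_monoid A\<^esub> y \<in> carrier (center_monoid A)"
    by (simp add: center_monoid_def)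
  show "x \<otimes>\<^bsub>center_monoid A\<^esub> y = y \<otimes>\<^bsub>center_monoid A\<^esub> x"
    by (simp add: center_monoid_def x [of y])
next
  show "\<one>\<^bsub>center_monoid A\<^esub> \<in> carrier (center_monoid A)"
    by (simp add: center_monoid_def unit_of_eq unit_left unit_right)
  show "\<one>\<^bsub>center_monoid A\<^esub> \<otimes>\<^bsub>center_monoid A\<^esub> x = x" for x
    by (simp add: center_monoid_def unit_of_eq unit_left)
  show "x \<otimes>\<^bsub>center_monoid A\<^esub> y \<otimes>\<^bsub>center_monoid A\<^esub> z
      = x \<otimes>\<^bsub>center_monoid A\<^esub> (y \<otimes>\<^bsub>center_monoid A\<^esub> z)" for x y z
    by (simp add: center_monoid_def assoc)
qed

lemma comm_group_center_units: "comm_group (center_units A)"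
  unfolding center_units_def by (rule comm_monoid.units_comm_group [OF comm_monoid_center])

lemma mult_center_units: "x \<otimes>\<^bsub>center_units A\<^esub> y = x \<odot> y"
  by (simp add: center_units_def units_of_mult center_monoid_def)

lemma one_center_units: "\<one>\<^bsub>center_units A\<^esub> = unit"
  by (simp add: center_units_def units_of_one center_monoid_def unit_of_eq)

lemma carrier_center_units:
  "z \<in> carrier (center_units A) \<longleftrightarrow>
    (\<forall>a. z \<odot> a = a \<odot> z) \<and> (\<exists>w. (\<forall>a. w \<odot> a = a \<odot> w) \<and> w \<odot> z = unit \<and> z \<odot> w = unit)"
  unfolding center_units_def units_of_carrier Units_def center_monoid_def mem_Collect_eq
    partial_object.simps monoid.simps unit_of_eq by blast

lemma center_units_central:
  assumes "z \<in> carrier (center_units A)"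
  shows "z \<odot> a = a \<odot> z"
  using assms unfolding carrier_center_units by blast

text \<open>A one-sided central inverse suffices because it commutes with \<open>z\<close>.\<close>

lemma center_unitsI:
  assumes "\<And>a. z \<odot> a = a \<odot> z" "\<And>a. w \<odot> a = a \<odot> w" "z \<odot> w = unit"
  shows "z \<in> carrier (center_units A)"
  unfolding carrier_center_units using assms(1,2,3) trans [OF assms(2) assms(3)] by blast

lemma hss_mult_hss_of:
  assumes "g \<in> carrier G"
  shows "hss_mult (hss_of G A \<phi>) g = (\<lambda>x y. \<phi> g \<odot> (x \<odot> y))"
  unfolding hss_of_def using assms raise_weight
  by (intro hss_mult_eqI bilinear_shifted) (simp add: weight_def)

section \<open>From a homomorphism to a homotopical state sum\<close>

context
  fixes G :: "('g, 'b) monoid_scheme" and \<phi> :: "'g \<Rightarrow> complex ^ 'n"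
  assumes group: "group G" and hom: "\<phi> \<in> center_homs G A"
begin

interpretation G: group G
  by (rule group)

lemma central_hom:
  assumes "g \<in> carrier G"
  shows "\<phi> g \<odot> a = a \<odot> \<phi> g"
  using hom assms by (intro center_units_central) (auto simp: center_homs_def hom_def)

lemma hom_mult:
  assumes "g \<in> carrier G" "h \<in> carrier G"
  shows "\<phi> (g \<otimes>\<^bsub>G\<^esub> h) = \<phi> g \<odot> \<phi> h"
  using hom assms by (auto simp: center_homs_def hom_def mult_center_units)

lemma hom_one: "\<phi> \<one>\<^bsub>G\<^esub> = unit"
proof -
  have "group_hom G (center_units A) \<phi>"
    using hom group comm_group_center_units
    by (simp add: group_hom_def group_hom_axioms_def center_homs_def comm_group_def)
  then show ?thesis
    using group_hom.hom_one one_center_units by metis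
qed

lemma underlying_hss_of: "underlying_tss G (hss_of G A \<phi>) = tss_of_algebra A"
  by (simp add: underlying_tss_def hss_of_def tss_of_algebra_eq weight_def hom_one)

lemma hss_algebra_hss_of: "hss_algebra G (hss_of G A \<phi>) = A"
  by (simp add: hss_algebra_def hss_mult_hss_of hom_one unit_left fun_eq_iff)

lemma hss_hom_hss_of: "hss_hom G (hss_of G A \<phi>) = \<phi>"
proof
  \<comment> \<open>Outside \<open>carrier G\<close> both sides are \<open>undefined\<close>, by the
    extensionality required in \<open>center_homs\<close>.\<close>
  show "hss_hom G (hss_of G A \<phi>) g = \<phi> g" for g
    using hom by (auto simp: hss_hom_def hss_action_def hss_algebra_hss_of hss_mult_hss_of
        unit_of_eq unit_left unit_right center_homs_def extensional_def)
qed

lemma hss_of_in_hss: "hss_of G A \<phi> \<in> hss G"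
proof -
  define C where "C = (\<lambda>g\<in>carrier G. weight (\<phi> g))"
  have H: "hss_of G A \<phi> = (C, matrix_inv (trace_form A))"
    by (simp add: hss_of_def C_def weight_def)
  have C: "C g = weight (\<phi> g)" if "g \<in> carrier G" for g
    using that by (simp add: C_def)
  \<comment> \<open>The right-hand side depends on \<open>g\<close> and \<open>h\<close> only
    through their product, so the three sums in the homotopy constraints coincide.\<close>
  have sum: "(\<Sum>k\<in>UNIV. raise (matrix_inv (trace_form A)) (C g) i j k * C h k l p)
      = ltrace (\<phi> (g \<otimes>\<^bsub>G\<^esub> h) \<odot> (axis i 1 \<odot> axis j 1 \<odot> axis l 1) \<odot> axis p 1)"
    if g: "g \<in> carrier G" and h: "h \<in> carrier G" for g h i j l p
  proof -
    have "(\<Sum>k\<in>UNIV. raise (matrix_inv (trace_form A)) (C g) i j k * C h k l p)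
        = ltrace (\<phi> h \<odot> (\<phi> g \<odot> (axis i 1 \<odot> axis j 1) \<odot> axis l 1) \<odot> axis p 1)"
      by (simp add: C g h raise_weight structure_const_def sum_weight)
    also have "\<phi> h \<odot> (\<phi> g \<odot> (axis i 1 \<odot> axis j 1) \<odot> axis l 1)
        = \<phi> h \<odot> \<phi> g \<odot> (axis i 1 \<odot> axis j 1 \<odot> axis l 1)"
      by (simp add: assoc)
    also have "\<phi> h \<odot> \<phi> g = \<phi> (g \<otimes>\<^bsub>G\<^esub> h)"
      by (simp add: hom_mult g h central_hom [OF h, of "\<phi> g"])
    finally show ?thesis .
  qed
  have "topological_state_sum (underlying_tss G (C, matrix_inv (trace_form A)))"
    using underlying_hss_of topological_state_sum_tss_of_algebra H by simp
  moreover have "cyclic (C g)" if "g \<in> carrier G" for g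
    unfolding C [OF that] by (intro cyclic_weight central_hom that)
  moreover have "C \<in> extensional (carrier G)"
    by (simp add: C_def)
  ultimately show ?thesis
    by (auto simp: H hss_def transpose_matrix_inv_trace_form invertible_matrix_inv
        invertible_trace_form sum)
qed

end

end

section \<open>From a homotopical state sum back to an algebra and a homomorphism\<close>

lemma hss_mult_axis: "hss_mult (C, m) g (axis i 1) (axis j 1) $ k = raise m (C g) i j k"
  using structure_const_hss_mult [of C m g] by (simp add: structure_const_def fun_eq_iff)

text \<open>The inner sum is the contraction occurring in the homotopy constraints; raising its free
  index \<open>p\<close> makes it a coefficient of an iterated product.\<close>

lemma hss_mult_hss_mult_axis:
  "hss_mult (C, m) h (hss_mult (C, m) g (axis i 1) (axis j 1)) (axis l 1) $ q
    = (\<Sum>p\<in>UNIV. (\<Sum>k\<in>UNIV. raise m (C g) i j k * C h k l p) * m $ p $ q)"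
proof -
  interpret bilinear_mult "hss_mult (C, m) h"
    by (rule bilinear_hss_mult)
  have "hss_mult (C, m) h (hss_mult (C, m) g (axis i 1) (axis j 1)) (axis l 1) $ q
      = (\<Sum>k\<in>UNIV. raise m (C g) i j k * raise m (C h) k l q)"
    by (simp add: nth_mult_axis hss_mult_axis structure_const_hss_mult)
  also have "\<dots> = (\<Sum>k\<in>UNIV. raise m (C g) i j k * (\<Sum>p\<in>UNIV. C h k l p * m $ p $ q))"
    by (simp only: raise_def [of m "C h"])
  also have "\<dots> = (\<Sum>p\<in>UNIV. (\<Sum>k\<in>UNIV. raise m (C g) i j k * C h k l p) * m $ p $ q)"
    by (simp add: sum_distrib_left sum_distrib_right mult.assoc) (rule sum.swap)
  finally show ?thesis .
qed

text \<open>The metric constraint identifies the lower-index metric with the trace form of the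
  algebra, so invertibility of \<open>m\<close> is non-degeneracy of that form.\<close>

lemma topological_state_sum_algebra:
  assumes "topological_state_sum (underlying_tss G (C, m))"
  shows "frobenius_mult (hss_algebra G (C, m))"
    and "trace_form (hss_algebra G (C, m)) = matrix_inv m"
proof -
  define A where "A = hss_algebra G (C, m)"
  interpret bilinear_mult A
    unfolding A_def hss_algebra_def by (rule bilinear_hss_mult)
  have S: "structure_const A = raise m (C \<one>\<^bsub>G\<^esub>)"
    by (simp add: A_def hss_algebra_def structure_const_hss_mult)
  have m: "invertible m"
    and ass: "(\<Sum>p\<in>UNIV. structure_const A i j p * structure_const A p k l)
      = (\<Sum>p\<in>UNIV. structure_const A j k p * structure_const A i p l)"
    and metric: "matrix_inv m $ i $ j
      = (\<Sum>k\<in>UNIV. \<Sum>l\<in>UNIV. structure_const A i k l * structure_const A j l k)" for i j k l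
    using assms unfolding S by (simp_all add: topological_state_sum_def underlying_tss_def)
  show tf: "trace_form (hss_algebra G (C, m)) = matrix_inv m"
    by (simp add: A_def [symmetric] trace_form_def vec_eq_iff metric)
  have axes: "A (A (axis i 1) (axis j 1)) (axis k 1) = A (axis i 1) (A (axis j 1) (axis k 1))"
    for i j k
  proof -
    have "A (A (axis i 1) (axis j 1)) (axis k 1) $ l = A (axis i 1) (A (axis j 1) (axis k 1)) $ l"
      for l
      using nth_mult_axis [of "A (axis i 1) (axis j 1)" k l]
        nth_axis_mult [of i "A (axis j 1) (axis k 1)" l] ass [of i j k l]
      by (simp add: structure_const_def)
    then show ?thesis
      by (simp add: vec_eq_iff)
  qed
  have "A (A x y) z = A x (A y z)" for x y z
    by (rule trilinear_eqI [of "\<lambda>x y z. A (A x y) z" "\<lambda>x y z. A x (A y z)"])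
       (auto intro!: linear_vecI simp: add_left add_right scale_left scale_right axes)
  then interpret assoc_mult A
    by unfold_locales
  show "frobenius_mult (hss_algebra G (C, m))"
    unfolding A_def [symmetric]
    by unfold_locales (use tf m in \<open>simp add: A_def invertible_matrix_inv\<close>)
qed

text \<open>The constraints force \<open>x *\<^sub>g y = \<phi>(g) x y\<close> for \<open>\<phi>(g) = e *\<^sub>g e\<close>, where \<open>*\<^sub>g\<close> is the bilinear
  map with coefficients \<open>C\<^sub>i\<^sub>j\<^sup>k(g)\<close>; cyclicity of \<open>C(g)\<close> makes \<open>\<phi>(g)\<close> central.\<close>

lemma hss_reconstruct:
  assumes G: "group G" and H: "H \<in> hss G"
  shows "frobenius_mult (hss_algebra G H)" (is ?frob)
    and "hss_hom G H \<in> center_homs G (hss_algebra G H)" (is ?hom)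
    and "hss_of G (hss_algebra G H) (hss_hom G H) = H" (is ?eq)
proof -
  interpret G: group G
    by (rule G)
  obtain C m where CM: "H = (C, m)"
    by (cases H)
  define A where "A = hss_algebra G H"
  define M where "M = hss_mult (C, m)"
  note conds = H [unfolded hss_def CM mem_Collect_eq prod.case]
  note ext = conds [THEN conjunct1]
  note m = conds [THEN conjunct2, THEN conjunct2, THEN conjunct1]
  note rest = conds [THEN conjunct2, THEN conjunct2, THEN conjunct2]
  note cyc = rest [THEN conjunct1, rule_format]
  note tss = rest [THEN conjunct2, THEN conjunct1]
  note constraints = rest [THEN conjunct2, THEN conjunct2, rule_format]
  note comp = constraints [THEN conjunct1]
  note comp' = constraints [THEN conjunct2]
  interpret frobenius_mult A
    unfolding A_def CM by (rule topological_state_sum_algebra(1) [OF tss])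
  show ?frob
    using frobenius_mult_axioms by (simp add: A_def)
  have tf: "trace_form A = matrix_inv m"
    unfolding A_def CM by (rule topological_state_sum_algebra(2) [OF tss])
  have M1: "M \<one>\<^bsub>G\<^esub> = A"
    by (simp add: M_def A_def CM hss_algebra_def)
  have bilin: "bilinear_mult (M g)" for g
    unfolding M_def by (rule bilinear_hss_mult)
  \<comment> \<open>Transports any equality of contractions, in particular each homotopy constraint,
    to an identity between iterated products of arbitrary vectors.\<close>
  have M_M: "M h (M g x y) z = M h' (M g' x y) z"
    if "\<And>i j l p. (\<Sum>k\<in>UNIV. raise m (C g) i j k * C h k l p)
          = (\<Sum>k\<in>UNIV. raise m (C g') i j k * C h' k l p)" for g h g' h' x y z
  proof (rule trilinear_eqI [of "\<lambda>x y z. M h (M g x y) z" "\<lambda>x y z. M h' (M g' x y) z"])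
    show "M h (M g (axis i 1) (axis j 1)) (axis k 1)
        = M h' (M g' (axis i 1) (axis j 1)) (axis k 1)" for i j k
      unfolding M_def vec_eq_iff hss_mult_hss_mult_axis that by simp
  qed (auto intro!: linear_vecI
      simp: bilinear_mult.add_left [OF bilin] bilinear_mult.add_right [OF bilin]
        bilinear_mult.scale_left [OF bilin] bilinear_mult.scale_right [OF bilin])
  have M_comp: "M h (M g x y) z = M (g \<otimes>\<^bsub>G\<^esub> h) (A x y) z"
    if "g \<in> carrier G" "h \<in> carrier G" for g h x y z
    unfolding M1 [symmetric] by (rule M_M) (rule comp [OF that])
  \<comment> \<open>The second homotopy constraint with the first colour equal to
    \<open>\<one>\<close>.\<close>
  have M_assoc: "M g (A x y) z = A (M g x y) z" if "g \<in> carrier G" for g x y z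
    using M_M [OF comp' [OF G.one_closed that], of x y z] that by (simp add: M1)
  define \<phi> where "\<phi> g = M g unit unit" for g
  have M_eq: "M g x y = A (\<phi> g) (A x y)" if "g \<in> carrier G" for g x y
  proof -
    \<comment> \<open>\<open>M_assoc\<close> is used twice with the unit in the first slot: first to
      compute \<open>M g unit z\<close>, then to pass from \<open>M g unit x\<close> to
      \<open>M g x y\<close>.\<close>
    have left: "M g unit z = A (\<phi> g) z" for z
      using M_assoc [OF that, of unit unit z] by (simp add: \<phi>_def unit_left)
    show ?thesis
      using M_assoc [OF that, of unit x y] by (simp add: unit_left left assoc)
  qed
  have C_eq: "C g = weight (\<phi> g)" if "g \<in> carrier G" for g
  proof -
    have "raise m (C g) = structure_const (M g)"
      by (simp add: M_def structure_const_hss_mult)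
    also have "M g = (\<lambda>x y. A (\<phi> g) (A x y))"
      using M_eq [OF that] by (simp add: fun_eq_iff)
    finally show ?thesis
      by (simp add: raise_eq_iff [OF m] weight_def tf)
  qed
  have hom: "hss_hom G H = (\<lambda>g\<in>carrier G. \<phi> g)"
    unfolding \<phi>_def unit_of_eq [symmetric] by (simp add: hss_hom_def hss_action_def A_def M_def CM)
  have central: "A (\<phi> g) a = A a (\<phi> g)" if "g \<in> carrier G" for g a
    using cyc [OF that] by (intro cyclic_weight_imp_central) (simp add: C_eq [OF that])
  have mult: "\<phi> (g \<otimes>\<^bsub>G\<^esub> h) = A (\<phi> g) (\<phi> h)" if g: "g \<in> carrier G" and h: "h \<in> carrier G" for g h
  proof -
    \<comment> \<open>Composition at the unit produces the factors in reverse order; centrality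
      restores it.\<close>
    have "A (\<phi> h) (\<phi> g) = \<phi> (g \<otimes>\<^bsub>G\<^esub> h)"
      using M_comp [OF g h, of unit unit unit]
      by (simp add: M_eq g h unit_left unit_right)
    then show ?thesis
      by (simp add: central [OF g, of "\<phi> h"])
  qed
  have one: "\<phi> \<one>\<^bsub>G\<^esub> = unit"
    by (simp add: \<phi>_def M1 unit_left)
  have carrier: "\<phi> g \<in> carrier (center_units A)" if "g \<in> carrier G" for g
  proof (rule center_unitsI)
    show "A (\<phi> g) (\<phi> (inv\<^bsub>G\<^esub> g)) = unit"
      using that by (simp add: mult [symmetric] one)
  qed (rule central; simp add: that)+
  show ?hom
    unfolding hom A_def [symmetric] center_homs_def hom_def
    by (auto simp: carrier mult mult_center_units)
  \<comment> \<open>Extensionality of \<open>C\<close> provides the agreement outside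
    \<open>carrier G\<close>.\<close>
  have "(\<lambda>g\<in>carrier G. weight (restrict \<phi> (carrier G) g)) = C"
    using ext by (auto simp: fun_eq_iff C_eq extensional_def)
  then have "hss_of G A (hss_hom G H) = (C, matrix_inv (trace_form A))"
    unfolding hss_of_def hom weight_def by simp
  then show ?eq
    unfolding tf matrix_inv_matrix_inv [OF m] unfolding A_def CM .
qed

section \<open>The correspondence with pairs, and reductions of the universal state sum\<close>

lemma bij_betw_hss:
  fixes G :: "('g, 'b) monoid_scheme"
  assumes G: "group G"
  shows "bij_betw (\<lambda>H. (hss_algebra G H, hss_hom G H)) (hss G)
    {(A :: 'n::finite multiplication, \<phi>). semisimple_algebra A \<and> \<phi> \<in> center_homs G A}"
proof (rule bij_betwI [where g = "\<lambda>(A, \<phi>). hss_of G A \<phi>"])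
  show "(\<lambda>H. (hss_algebra G H, hss_hom G H)) \<in> hss G \<rightarrow>
      {(A, \<phi>). semisimple_algebra A \<and> \<phi> \<in> center_homs G A}"
    using hss_reconstruct [OF G] by (auto simp: semisimple_algebra_iff)
  show "(\<lambda>(A, \<phi>). hss_of G A \<phi>) \<in>
      {(A, \<phi>). semisimple_algebra A \<and> \<phi> \<in> center_homs G A} \<rightarrow> hss G"
    using frobenius_mult.hss_of_in_hss [OF _ G] by (auto simp: semisimple_algebra_iff)
qed (auto simp: hss_reconstruct [OF G] semisimple_algebra_iff
    frobenius_mult.hss_algebra_hss_of [OF _ G] frobenius_mult.hss_hom_hss_of [OF _ G])

lemma hss_algebra_cong:
  assumes "underlying_tss G H = underlying_tss G K"
  shows "hss_algebra G H = hss_algebra G K"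
  using assms
  by (auto simp: underlying_tss_def hss_algebra_def hss_mult_def split: prod.splits)

context frobenius_mult
begin

lemma id_in_center_homs: "(\<lambda>z\<in>carrier (center_units A). z) \<in> center_homs (center_units A) A"
proof -
  interpret comm_group "center_units A"
    by (rule comm_group_center_units)
  show ?thesis
    by (auto simp: center_homs_def hom_def)
qed

text \<open>The state sum of the identity homomorphism is universal: its weight at
  \<open>\<phi> g\<close> is by construction the weight of \<open>\<phi>\<close> at
  \<open>g\<close>, as \<open>\<phi> g\<close> is a central unit.\<close>

lemma reduce_hss_of:
  assumes "\<phi> \<in> center_homs G A"
  shows "reduce_hss G \<phi> (hss_of (center_units A) A (\<lambda>z\<in>carrier (center_units A). z))
    = hss_of G A \<phi>"
  using assms by (auto simp: reduce_hss_def hss_of_def center_homs_def hom_def fun_eq_iff)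

text \<open>On \<open>center_homs G A\<close> reduction agrees with \<open>hss_of G A\<close>, whose
  inverse on the fibre over \<open>tss_of_algebra A\<close> is \<open>hss_hom G\<close>.\<close>

lemma bij_betw_reduce_hss:
  fixes G :: "('g, 'b) monoid_scheme"
  assumes G: "group G"
  shows "bij_betw
    (\<lambda>\<phi>. reduce_hss G \<phi> (hss_of (center_units A) A (\<lambda>z\<in>carrier (center_units A). z)))
    (center_homs G A) {K \<in> hss G. underlying_tss G K = tss_of_algebra A}"
proof -
  have inverse: "hss_hom G K \<in> center_homs G A \<and> hss_of G A (hss_hom G K) = K"
    if "K \<in> hss G" "underlying_tss G K = tss_of_algebra A" for K
  proof -
    \<comment> \<open>The trivial homomorphism supplies a state sum with the same topological data
      and known algebra \<open>A\<close>; since the algebra depends only on these data,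
      \<open>K\<close> has algebra \<open>A\<close> too.\<close>
    let ?one = "\<lambda>g\<in>carrier G. unit"
    have "?one \<in> center_homs G A"
      using group.is_monoid [OF G] comm_group.axioms(1) [OF comm_group_center_units]
      by (auto simp: center_homs_def hom_def mult_center_units unit_left monoid.m_closed
          carrier_center_units unit_right)
    then have "hss_algebra G K = A"
      using that(2) hss_algebra_cong hss_algebra_hss_of [OF G] underlying_hss_of [OF G] by metis
    then show ?thesis
      using hss_reconstruct [OF G that(1)] by simp
  qed
  have "bij_betw (hss_of G A) (center_homs G A) {K \<in> hss G. underlying_tss G K = tss_of_algebra A}"
    by (rule bij_betwI [where g = "hss_hom G"])
       (auto simp: inverse hss_of_in_hss [OF G] underlying_hss_of [OF G] hss_hom_hss_of [OF G])
  then show ?thesis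
    by (subst bij_betw_cong [OF reduce_hss_of])
qed

end

theorem theorem3p1:
  shows
    "(\<forall>A :: 'n::finite multiplication. semisimple_algebra A \<longrightarrow>
        comm_group (center_units A) \<and>
        (\<exists>H \<in> hss (center_units A).
           underlying_tss (center_units A) H = tss_of_algebra A \<and>
           hss_hom (center_units A) H = (\<lambda>z\<in>carrier (center_units A). z) \<and>
           (\<forall>G :: ('g, 'b) monoid_scheme. comm_group G \<longrightarrow>
              bij_betw (\<lambda>\<phi>. reduce_hss G \<phi> H) (center_homs G A)
                {K \<in> hss G. underlying_tss G K = tss_of_algebra A})))
     \<and>
     (\<forall>G :: ('g, 'b) monoid_scheme. comm_group G \<longrightarrow>
        bij_betw (\<lambda>H. (hss_algebra G H, hss_hom G H)) (hss G)
          {(A :: 'n multiplication, \<phi>). semisimple_algebra A \<and> \<phi> \<in> center_homs G A})"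
proof (intro conjI allI impI)
  fix A :: "'n multiplication"
  assume "semisimple_algebra A"
  then interpret frobenius_mult A
    by (simp add: semisimple_algebra_iff)
  show "comm_group (center_units A)"
    by (rule comm_group_center_units)
  then have units: "group (center_units A)"
    by (rule comm_group.axioms)
  let ?H = "hss_of (center_units A) A (\<lambda>z\<in>carrier (center_units A). z)"
  show "\<exists>H \<in> hss (center_units A).
      underlying_tss (center_units A) H = tss_of_algebra A \<and>
      hss_hom (center_units A) H = (\<lambda>z\<in>carrier (center_units A). z) \<and>
      (\<forall>G :: ('g, 'b) monoid_scheme. comm_group G \<longrightarrow>
        bij_betw (\<lambda>\<phi>. reduce_hss G \<phi> H) (center_homs G A)
          {K \<in> hss G. underlying_tss G K = tss_of_algebra A})"
    using units id_in_center_homs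
    by (intro bexI [of _ ?H] conjI allI impI hss_of_in_hss underlying_hss_of hss_hom_hss_of
        bij_betw_reduce_hss comm_group.axioms(2) comm_group_center_units)
next
  fix G :: "('g, 'b) monoid_scheme"
  assume "comm_group G"
  then show "bij_betw (\<lambda>H. (hss_algebra G H, hss_hom G H)) (hss G)
      {(A :: 'n multiplication, \<phi>). semisimple_algebra A \<and> \<phi> \<in> center_homs G A}"
    by (intro bij_betw_hss) (rule comm_group.axioms)
qed

end
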